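(* There is an absolute constant $c>0$ such that the following holds for every integer $n$ and every $\varepsilon\in[2/n,1/2]$. Suppose $\mathrm{sk}(\cdot)$ is a sketching algorithm that outputs at most $s=s(n,\varepsilon)$ bits and $\mathrm{est}$ is an estimation algorithm such that together, for every $n$-vertex (unweighted) graph $G=(V,E)$, $$\forall S\subset V,\qquad \Pr\big[\mathrm{est}(S,\mathrm{sk}(G))\in(1\pm\varepsilon)\cdot|\partial(S,\bar S)|\big]\ge 9/10 .$$ Then $s\ge c\,n/\varepsilon$.
   Context: Graphs are undirected. $\bar S=V\setminus S$ and $\partial(S,\bar S)=\{(u,v)\in E: u\in S, v\in\bar S\}$. The sketching algorithm is a (possibly randomized) map from graphs on a fixed vertex set of size $n$ to bit strings; the estimation algorithm sees only the query $S$ and the sketch (no other access to $G$). The probability is over the randomness of the two algorithms, which may be shared. $X\in(1\pm\varepsilon)Y$ means $(1-\varepsilon)Y\le X\le(1+\varepsilon)Y$. *)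

theory Defs
  imports "HOL-Probability.Probability" "Graph_Theory.Pair_Digraph"
begin

(* Undirected simple graphs are pair_graph: finite, loop-free, with a symmetric arc relation.
   The edge uv is the two arcs (u,v) and (v,u); exactly one of them leaves S if uv is cut,
   so card (cut G S) counts undirected cut edges once. *)

definition graphs_on :: "'a set \<Rightarrow> 'a pair_pre_digraph set" where
  "graphs_on V = {G. pair_graph G \<and> pverts G = V}"

definition cut :: "'a pair_pre_digraph \<Rightarrow> 'a set \<Rightarrow> ('a \<times> 'a) set" where
  "cut G S = {(u, v) \<in> parcs G. u \<in> S \<and> v \<in> pverts G - S}"

definition approx :: "real \<Rightarrow> real \<Rightarrow> real set" where
  "approx \<epsilon> y = {(1 - \<epsilon>) * y .. (1 + \<epsilon>) * y}"

type_synonym 'a sketcher = "'a pair_pre_digraph \<Rightarrow> bool list"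
type_synonym 'a estimator = "'a set \<Rightarrow> bool list \<Rightarrow> real"

(* Both algorithms read the same random seed, drawn from M; private randomness is the case of a
   product space M. Non-measurable sets have measure 0, so the last conjunct also says that each
   success event is measurable. *)

definition cut_sketch ::
  "'a set \<Rightarrow> real \<Rightarrow> nat \<Rightarrow> 'r measure \<Rightarrow> ('r \<Rightarrow> 'a sketcher) \<Rightarrow> ('r \<Rightarrow> 'a estimator) \<Rightarrow> bool" where
  "cut_sketch V \<epsilon> s M sk est \<longleftrightarrow>
     prob_space M \<and>
     (\<forall>G \<in> graphs_on V. \<forall>\<omega> \<in> space M. length (sk \<omega> G) \<le> s) \<and>
     (\<forall>G \<in> graphs_on V. \<forall>S. S \<subset> V \<longrightarrow>
        measure M {\<omega> \<in> space M. est \<omega> S (sk \<omega> G) \<in> approx \<epsilon> (real (card (cut G S)))} \<ge> 9 / 10)"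

(* A universal seed type: pairs of deterministic algorithms. HOL cannot quantify over the type 'r
   underneath the existential quantifier of an absolute constant, so such a statement has to fix
   the seed type. By the lemma below this loses nothing. *)

type_synonym 'a seed = "'a sketcher \<times> 'a estimator"

lemma cut_sketch_seed:
  fixes M :: "'r measure" and sk :: "'r \<Rightarrow> 'a sketcher" and est :: "'r \<Rightarrow> 'a estimator"
  assumes "cut_sketch V \<epsilon> s M sk est"
  shows "\<exists>N :: 'a seed measure. cut_sketch V \<epsilon> s N fst snd"
proof -
  define f where "f = (\<lambda>\<omega>. (sk \<omega>, est \<omega>))"
  define F where "F = {A. A \<subseteq> f ` space M \<and> f -` A \<inter> space M \<in> sets M}"
  define N where "N = distr M (sigma (f ` space M) F) f"
  interpret prob_space M using assms by (simp add: cut_sketch_def)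
  have F: "F \<subseteq> Pow (f ` space M)" by (auto simp: F_def)
  have f: "f \<in> measurable M (sigma (f ` space M) F)"
    by (rule measurable_measure_of[OF F]) (auto simp: F_def)
  have spN: "space N = f ` space M"
    by (simp add: N_def space_measure_of[OF F])
  have "prob_space N" unfolding N_def by (rule prob_space_distr[OF f])
  moreover have "length (fst x G) \<le> s" if "G \<in> graphs_on V" "x \<in> space N" for x G
    using that assms by (auto simp: spN f_def cut_sketch_def)
  moreover have "measure N {x \<in> space N. snd x S (fst x G) \<in> I} \<ge> 9 / 10"
    if "G \<in> graphs_on V" "S \<subset> V" and I: "I = approx \<epsilon> (real (card (cut G S)))" for G S I
  proof -
    let ?A = "{x \<in> space N. snd x S (fst x G) \<in> I}"
    let ?B = "{\<omega> \<in> space M. est \<omega> S (sk \<omega> G) \<in> I}"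
    have B: "measure M ?B \<ge> 9 / 10" using assms that by (auto simp: cut_sketch_def)
    then have "?B \<in> sets M" using measure_notin_sets[of ?B M] by fastforce
    moreover have AB: "f -` ?A \<inter> space M = ?B" by (auto simp: spN f_def)
    ultimately have "?A \<in> F" by (auto simp: F_def spN)
    then have "?A \<in> sets (sigma (f ` space M) F)" using F by (simp add: sets_measure_of)
    then have "measure N ?A = measure M (f -` ?A \<inter> space M)"
      unfolding N_def by (rule measure_distr[OF f])
    with AB B show ?thesis by simp
  qed
  ultimately have "cut_sketch V \<epsilon> s N fst snd" by (simp add: cut_sketch_def)
  then show ?thesis by blast
qed

end

(* Take about n/(2k) vertex-disjoint copies of K_{k,k} with k of order 1/eps; their subgraphs
   encode order n/eps bits. The bit of a pair uv is read off three cut queries, because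
   cut{u} + cut{v} - cut{u,v} is 2 or 0 according to whether uv is an edge, and all three cuts have
   size O(1/eps), so the total estimation error is less than the gap. The sketch is thus a random
   access code with success probability 7/10 per bit. After fixing a good seed, averaging
   2^(number of correctly decoded bits) over all subgraphs shows that the code length is linear in
   the number of bits. *)
theory Submission
  imports Defs
begin

section \<open>Counting and averaging for random access codes\<close>

text \<open>The crude \<open>4 ^ s\<close> stands in for 2^(s+1) - 1 because it is a pure power of
  value 1 at s = 0; the final bound \<open>20 * s\<close> then carries no additive term.\<close>

lemma card_bool_lists_length_le: "card {xs :: bool list. length xs \<le> s} \<le> 4 ^ s"
proof -
  have "card {xs :: bool list. length xs \<le> s} = (\<Sum>i\<le>s. 2 ^ i)"
    using card_lists_length_le[of "UNIV :: bool set" s] by (simp add: numeral_2_eq_2)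
  also have "\<dots> \<le> 4 ^ s"
  proof (induction s)
    case (Suc s)
    have "(2::nat) ^ s \<le> 4 ^ s" by (rule power_mono) auto
    then have "(2::nat) ^ Suc s + 4 ^ s \<le> 4 ^ Suc s" by simp
    with Suc show ?case by simp
  qed simp
  finally show ?thesis .
qed

text \<open>By linearity the expected number of events that occur is at least
  \<open>p * card J\<close>, so some outcome reaches this value. It serves to fix one seed for all
  encoded sets and all bits at once.\<close>

lemma (in prob_space) exists_many_events:
  fixes A :: "'j \<Rightarrow> 'a set"
  assumes J: "finite J" and A: "\<And>j. j \<in> J \<Longrightarrow> A j \<in> events"
    and p: "\<And>j. j \<in> J \<Longrightarrow> p \<le> prob (A j)"
  shows "\<exists>\<omega> \<in> space M. p * card J \<le> card {j \<in> J. \<omega> \<in> A j}"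
proof (rule ccontr)
  let ?X = "\<lambda>\<omega>. \<Sum>j\<in>J. indicat_real (A j) \<omega>"
  assume *: "\<not> ?thesis"
  have int: "integrable M (indicat_real (A j))" if "j \<in> J" for j
    using A[OF that] by (simp add: integrable_indicator_iff emeasure_eq_measure)
  have X: "?X \<omega> = card {j \<in> J. \<omega> \<in> A j}" for \<omega>
    using J by (simp add: indicator_def sum.If_cases Int_def)
  have "expectation ?X < p * card J"
  proof (rule expectation_less)
    show "integrable M ?X" using int by auto
    show "AE \<omega> in M. ?X \<omega> < p * card J" using * by (intro AE_I2) (auto simp: X not_le)
  qed
  moreover have "expectation ?X = (\<Sum>j\<in>J. prob (A j))"
    using int A by (simp add: Bochner_Integration.integral_sum)
  moreover have "(\<Sum>j\<in>J. p) \<le> (\<Sum>j\<in>J. prob (A j))" by (rule sum_mono) (rule p)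
  ultimately show False by (simp add: mult.commute)
qed

text \<open>The sum factors over the coordinates: of the two choices for i, in X or not, exactly one
  agrees with Y and has weight \<open>a\<close>, while the other has weight 1. As the value does not
  depend on Y, every message will contribute the same amount.\<close>

lemma sum_Pow_power_agreement:
  fixes a :: real
  assumes "finite I"
  shows "(\<Sum>X\<in>Pow I. a ^ card {i \<in> I. i \<in> X \<longleftrightarrow> i \<in> Y}) = (1 + a) ^ card I"
proof -
  define f where "f = (\<lambda>i. if i \<in> Y then a else 1)"
  define g where "g = (\<lambda>i. if i \<in> Y then 1 else a)"
  have "a ^ card {i \<in> I. i \<in> X \<longleftrightarrow> i \<in> Y} = (\<Prod>i\<in>X. f i) * (\<Prod>i\<in>I - X. g i)"
    if "X \<in> Pow I" for X
  proof -
    have fin: "finite X" "finite (I - X)" using that assms by (auto intro: finite_subset)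
    have "(\<Prod>i\<in>X. f i) = a ^ card (X \<inter> Y)" using fin
      by (simp add: f_def prod.If_cases Int_def)
    moreover have "(\<Prod>i\<in>I - X. g i) = a ^ card ((I - X) \<inter> - Y)" using fin
      by (simp add: g_def prod.If_cases Int_def)
    moreover have "{i \<in> I. i \<in> X \<longleftrightarrow> i \<in> Y} = (X \<inter> Y) \<union> ((I - X) \<inter> - Y)"
      using that by auto
    moreover have "card ((X \<inter> Y) \<union> ((I - X) \<inter> - Y)) = card (X \<inter> Y) + card ((I - X) \<inter> - Y)"
      by (rule card_Un_disjoint) (use fin in auto)
    ultimately show ?thesis by (simp add: power_add)
  qed
  then have "(\<Sum>X\<in>Pow I. a ^ card {i \<in> I. i \<in> X \<longleftrightarrow> i \<in> Y}) = (\<Prod>i\<in>I. f i + g i)"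
    using assms by (subst prod_add) auto
  also have "\<dots> = (\<Prod>i\<in>I. 1 + a)" by (rule prod.cong) (auto simp: f_def g_def)
  finally show ?thesis by simp
qed

(* The exponential moment with base 2 suffices: each bit contributes a factor 2 * 2^(7/10) / 3, and
   its tenth power 2^17 / 3^10 exceeds 2. *)
lemma random_access_code_bound:
  fixes enc :: "'i set \<Rightarrow> 'm" and dec :: "'m \<Rightarrow> 'i set"
  assumes I: "finite I" and B: "finite B" "card B \<le> 4 ^ s" and enc: "\<And>X. X \<subseteq> I \<Longrightarrow> enc X \<in> B"
    and avg: "7 / 10 * (card I * 2 ^ card I)
      \<le> (\<Sum>X\<in>Pow I. real (card {i \<in> I. i \<in> X \<longleftrightarrow> i \<in> dec (enc X)}))"
  shows "card I \<le> 20 * s"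
proof -
  define l where "l = card I"
  define t where "t X Y = card {i \<in> I. i \<in> X \<longleftrightarrow> i \<in> Y}" for X Y
  define t0 where "t0 = 7 / 10 * real l"
  \<comment> \<open>By convexity 2^m lies above its tangent at \<open>t0\<close>; summed over X this
    is Jensen's inequality.\<close>
  have tangent: "2 powr t0 * (1 + ln 2 * (real m - t0)) \<le> 2 ^ m" for m
  proof -
    have "2 powr t0 * (1 + ln 2 * (real m - t0)) \<le> 2 powr t0 * exp (ln 2 * (real m - t0))"
      by (rule mult_left_mono) (rule exp_ge_add_one_self, simp)
    also have "\<dots> = 2 powr (t0 + (real m - t0))"
      by (simp only: powr_add) (simp add: powr_def mult.commute)
    finally show ?thesis by (simp add: powr_realpow)
  qed
  have cardPow: "(\<Sum>X\<in>Pow I. (c::real)) = 2 ^ l * c" for c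
    using I by (simp add: card_Pow l_def)
  \<comment> \<open>By \<open>avg\<close> the factor multiplied by \<open>ln 2\<close> is
    nonnegative.\<close>
  have "2 powr t0 * 2 ^ l \<le> 2 powr t0 * (2 ^ l + ln 2 * ((\<Sum>X\<in>Pow I. real (t X (dec (enc X)))) - 2 ^ l * t0))"
    using avg by (intro mult_left_mono) (auto simp: t_def t0_def l_def mult_ac)
  also have "\<dots> = (\<Sum>X\<in>Pow I. 2 powr t0 * (1 + ln 2 * (real (t X (dec (enc X))) - t0)))"
    by (simp only: sum_distrib_left[symmetric] sum.distrib sum_subtractf cardPow mult_1_right)
  also have "\<dots> \<le> (\<Sum>X\<in>Pow I. 2 ^ t X (dec (enc X)))" by (rule sum_mono) (rule tangent)
  \<comment> \<open>Summing over all messages frees the decoded set from its dependence on X, so the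
    product formula applies to each message.\<close>
  also have "\<dots> \<le> (\<Sum>X\<in>Pow I. \<Sum>m\<in>B. 2 ^ t X (dec m))"
  proof (rule sum_mono)
    fix X assume "X \<in> Pow I"
    then have "enc X \<in> B" using enc by auto
    then show "(2::real) ^ t X (dec (enc X)) \<le> (\<Sum>m\<in>B. 2 ^ t X (dec m))"
      using B by (intro member_le_sum) auto
  qed
  also have "\<dots> = (\<Sum>m\<in>B. 3 ^ l)"
    by (subst sum.swap) (simp add: t_def l_def sum_Pow_power_agreement[OF I])
  also have "\<dots> \<le> 4 ^ s * 3 ^ l" using B(2) by simp
  finally have "(2 powr t0 * 2 ^ l) ^ 10 \<le> (4 ^ s * 3 ^ l :: real) ^ 10"
    by (rule power_mono) simp
  moreover have "(2 powr t0) ^ 10 = (2::real) ^ (7 * l)"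
  proof -
    have "(2 powr t0) ^ 10 = 2 powr real (7 * l)" by (simp only: powr_power) (simp add: t0_def)
    also have "\<dots> = 2 ^ (7 * l)" by (rule powr_realpow) simp
    finally show ?thesis .
  qed
  ultimately have "(2::real) ^ (17 * l) \<le> 4 ^ (s * 10) * 3 ^ (l * 10)"
    by (simp add: power_mult_distrib flip: power_mult power_add)
  also have "\<dots> = 2 ^ (20 * s) * (3 ^ 10) ^ l"
    using power_mult[of "2::real" 2 "s * 10"] power_mult[of "3::real" 10 l] by (simp add: mult.commute)
  \<comment> \<open>3^10 = 59049 is below 2^16 = 65536, which leaves one factor 2 per bit.\<close>
  also have "\<dots> \<le> 2 ^ (20 * s) * (2 ^ 16) ^ l" by (intro mult_left_mono power_mono) auto
  also have "\<dots> = 2 ^ (20 * s + 16 * l)" by (simp only: power_add power_mult)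
  finally have "17 * l \<le> 20 * s + 16 * l" by simp
  then show ?thesis by (simp add: l_def)
qed

section \<open>From cut queries to random access codes\<close>

text \<open>An arc that leaves u or v either leaves the pair or is one of (u, v) and (v, u). By
  symmetry these two are both present or both absent.\<close>

lemma card_cut_pair:
  assumes "pair_graph G" and "u \<noteq> v"
  shows "card (cut G {u}) + card (cut G {v})
    = card (cut G {u, v}) + (if (u, v) \<in> parcs G then 2 else 0)"
proof -
  interpret pair_graph G by fact
  have fin: "finite (cut G S)" for S by (rule finite_subset[of _ "parcs G"]) (auto simp: cut_def)
  have sym: "(u, v) \<in> parcs G \<longleftrightarrow> (v, u) \<in> parcs G"
    by (meson arcs_symmetric)
  have V: "x \<in> pverts G \<and> y \<in> pverts G \<and> x \<noteq> y" if "(x, y) \<in> parcs G" for x y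
    using that by (auto dest: in_arcsD1 in_arcsD2 no_loops')
  define D where "D = parcs G \<inter> {(u, v), (v, u)}"
  have "card (cut G {u}) + card (cut G {v}) = card (cut G {u} \<union> cut G {v})"
    using assms by (subst card_Un_disjoint) (auto simp: fin, auto simp: cut_def)
  also have "cut G {u} \<union> cut G {v} = cut G {u, v} \<union> D"
    using assms V by (auto simp: cut_def D_def)
  also have "card \<dots> = card (cut G {u, v}) + card D"
    by (subst card_Un_disjoint) (auto simp: fin D_def, auto simp: cut_def)
  also have "card D = (if (u, v) \<in> parcs G then 2 else 0)"
    using assms sym by (auto simp: D_def)
  finally show ?thesis .
qed

lemma card_cut_singleton:
  assumes "pair_graph G"
  shows "card (cut G {u}) = card (parcs G `` {u})"
proof -
  interpret pair_graph G by fact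
  have "cut G {u} = Pair u ` (parcs G `` {u})"
    by (auto simp: cut_def dest: in_arcsD2 no_loops')
  then show ?thesis by (simp add: card_image inj_on_def)
qed

(* The slack is sharp: a non-edge leaves each degree at most k - 1, an edge lowers the cut of the
   pair by 2, so k = 1 still works at eps = 1/2. *)
lemma estimates_decide_edge:
  fixes x y z \<epsilon> :: real
  assumes G: "pair_graph G" and uv: "u \<noteq> v"
    and k: "card (insert v (parcs G `` {u})) \<le> k" "card (insert u (parcs G `` {v})) \<le> k"
    and \<epsilon>: "0 < \<epsilon>" "\<epsilon> * (4 * real k - 2) \<le> 1"
    and x: "x \<in> approx \<epsilon> (card (cut G {u}))" and y: "y \<in> approx \<epsilon> (card (cut G {v}))"
    and z: "z \<in> approx \<epsilon> (card (cut G {u, v}))"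
  shows "1 \<le> x + y - z \<longleftrightarrow> (u, v) \<in> parcs G"
proof -
  interpret pair_graph G by fact
  define a where "a = real (card (cut G {u}))"
  define b where "b = real (card (cut G {v}))"
  define c where "c = real (card (cut G {u, v}))"
  have fin: "finite (parcs G `` {w})" for w
    by (rule finite_subset[of _ "snd ` parcs G"]) (force, simp)
  have sym: "(u, v) \<in> parcs G \<longleftrightarrow> (v, u) \<in> parcs G"
    by (meson arcs_symmetric)
  have abc: "a + b = c + (if (u, v) \<in> parcs G then 2 else 0)"
    using card_cut_pair[OF G uv] unfolding a_def b_def c_def
    by (auto simp flip: of_nat_add split: if_splits)
  have e: "x \<le> a + \<epsilon> * a" "y \<le> b + \<epsilon> * b" "c - \<epsilon> * c \<le> z"
    "a - \<epsilon> * a \<le> x" "b - \<epsilon> * b \<le> y" "z \<le> c + \<epsilon> * c"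
    using x y z by (auto simp: approx_def a_def b_def c_def algebra_simps)
  show ?thesis
  proof (cases "(u, v) \<in> parcs G")
    case True
    then have "a \<le> k" "b \<le> k"
      using k sym by (auto simp: a_def b_def card_cut_singleton[OF G] insert_absorb)
    then have "\<epsilon> * (a + b + c) \<le> \<epsilon> * (4 * real k - 2)"
      using abc True \<epsilon> by (intro mult_left_mono) auto
    with \<epsilon> have "\<epsilon> * a + \<epsilon> * b + \<epsilon> * c \<le> 1" by (simp add: distrib_left)
    with e abc True show ?thesis by simp
  next
    \<comment> \<open>The threshold 1 is inclusive, so the error must be strictly below 1 here; the
      smaller total 4k - 4 and \<epsilon> > 0 give this.\<close>
    case False
    then have "a + 1 \<le> k" "b + 1 \<le> k"
      using k sym fin by (auto simp: a_def b_def card_cut_singleton[OF G])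
    then have "\<epsilon> * (a + b + c) \<le> \<epsilon> * (4 * real k - 4)"
      using abc False \<epsilon> by (intro mult_left_mono) auto
    with \<epsilon> have "\<epsilon> * a + \<epsilon> * b + \<epsilon> * c < 1" by (simp add: distrib_left right_diff_distrib)
    with e abc False show ?thesis by simp
  qed
qed

(* I is the oriented edge set of a bipartite host graph; its subsets X are the encoded strings. *)
lemma cut_sketch_host_bound:
  fixes V :: "'a set" and I :: "('a \<times> 'a) set"
  assumes cs: "cut_sketch V \<epsilon> s M sk est" and V: "finite V" "3 \<le> card V" and IV: "I \<subseteq> V \<times> V"
    and bip: "Domain I \<inter> Range I = {}"
    and out: "\<And>u. card (I `` {u}) \<le> k" and into: "\<And>v. card (I\<inverse> `` {v}) \<le> k"
    and \<epsilon>: "0 < \<epsilon>" "\<epsilon> * (4 * real k - 2) \<le> 1"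
  shows "card I \<le> 20 * s"
proof -
  interpret prob_space M using cs by (simp add: cut_sketch_def)
  have I: "finite I" using IV V by (meson finite_SigmaI finite_subset)
  define G where "G X = \<lparr>pverts = V, parcs = X \<union> X\<inverse>\<rparr>" for X :: "('a \<times> 'a) set"
  have G: "pair_graph (G X)" if "X \<subseteq> I" for X
  proof -
    have "finite X" using that I finite_subset by auto
    then show ?thesis using that IV V bip
      by unfold_locales (auto simp: G_def symmetric_def sym_def, blast+)
  qed
  then have GV: "G X \<in> graphs_on V" if "X \<subseteq> I" for X
    using that by (simp add: graphs_on_def G_def)
  define E where "E X S = {\<omega> \<in> space M. est \<omega> S (sk \<omega> (G X)) \<in> approx \<epsilon> (real (card (cut (G X) S)))}"
    for X S
  have prob_E: "prob (E X S) \<ge> 9 / 10" if "X \<subseteq> I" "S \<subset> V" for X S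
    using cs GV[OF that(1)] that(2) by (auto simp: cut_sketch_def E_def)
  then have ev_E: "E X S \<in> events" if "X \<subseteq> I" "S \<subset> V" for X S
    using prob_E[OF that] measure_notin_sets[of "E X S" M] by (cases "E X S \<in> events") auto
  define A where "A = (\<lambda>(X, u, v). E X {u} \<inter> E X {v} \<inter> E X {u, v})"
  have A: "A (X, u, v) \<in> events" "7 / 10 \<le> prob (A (X, u, v))"
    if X: "X \<subseteq> I" and uv: "(u, v) \<in> I" for X u v
  proof -
    \<comment> \<open>Queries must be proper subsets of V; a pair is one because V has at least 3
      elements.\<close>
    have sub: "S \<subset> V" if "S \<subseteq> {u, v}" for S
    proof -
      have "card S \<le> card {u, v}" by (rule card_mono) (use that in auto)
      also have "\<dots> \<le> 2" by (simp add: card_insert_if)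
      finally show ?thesis using that uv IV V by auto
    qed
    then have *: "{u} \<subset> V" "{v} \<subset> V" "{u, v} \<subset> V" by auto
    note ev = ev_E[OF X *(1)] ev_E[OF X *(2)] ev_E[OF X *(3)]
    note pr = prob_E[OF X *(1)] prob_E[OF X *(2)] prob_E[OF X *(3)]
    show "A (X, u, v) \<in> events" using ev by (simp add: A_def)
    \<comment> \<open>Two applications lower the success probability from 9/10 to 8/10 and then to
      7/10.\<close>
    have bonferroni: "prob P + prob Q - 1 \<le> prob (P \<inter> Q)" if "P \<in> events" "Q \<in> events" for P Q
      using finite_measure_Union'[of P Q] finite_measure_Diff'[of Q P] prob_le_1[of "P \<union> Q"] that
      by (simp add: Int_commute)
    show "7 / 10 \<le> prob (A (X, u, v))"
      using bonferroni[of "E X {u}" "E X {v}"] bonferroni[of "E X {u} \<inter> E X {v}" "E X {u, v}"] ev pr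
      by (simp add: A_def)
  qed
  obtain \<omega> where \<omega>: "\<omega> \<in> space M"
    and many: "7 / 10 * card (Pow I \<times> I) \<le> card {j \<in> Pow I \<times> I. \<omega> \<in> A j}"
    using exists_many_events[of "Pow I \<times> I" A "7 / 10"] A I by fastforce
  define enc where "enc X = sk \<omega> (G X)" for X
  \<comment> \<open>The threshold 1 is midway between the exact values 0 and 2. Pairs outside
    \<open>I\<close> may be decoded too, but only agreement on \<open>I\<close> is counted.\<close>
  define dec where "dec m = {(u, v). 1 \<le> est \<omega> {u} m + est \<omega> {v} m - est \<omega> {u, v} m}" for m
  have correct: "i \<in> X \<longleftrightarrow> i \<in> dec (enc X)" if X: "X \<subseteq> I" and i: "i \<in> I" and "\<omega> \<in> A (X, i)" for X i
  proof -
    obtain u v where uv: "i = (u, v)" by force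
    have fin: "finite (I `` {u})" "finite (I\<inverse> `` {v})" using I by auto
    \<comment> \<open>By \<open>bip\<close> u is only a source and v only a sink, so their
      neighbours in \<open>G X\<close> are neighbours in the host; adding the other endpoint stays
      inside because (u, v) is in \<open>I\<close>.\<close>
    have "insert v (parcs (G X) `` {u}) \<subseteq> I `` {u}" "insert u (parcs (G X) `` {v}) \<subseteq> I\<inverse> `` {v}"
      using bip X i uv by (auto simp: G_def)
    then have k: "card (insert v (parcs (G X) `` {u})) \<le> k" "card (insert u (parcs (G X) `` {v})) \<le> k"
      using out into fin by (meson card_mono order_trans)+
    have "u \<noteq> v" using bip i uv by auto
    then have "1 \<le> est \<omega> {u} (enc X) + est \<omega> {v} (enc X) - est \<omega> {u, v} (enc X)
        \<longleftrightarrow> (u, v) \<in> parcs (G X)"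
      using that uv by (intro estimates_decide_edge[OF G[OF X] _ k \<epsilon>]) (auto simp: A_def E_def enc_def)
    moreover have "(u, v) \<in> parcs (G X) \<longleftrightarrow> (u, v) \<in> X" using bip X i uv by (auto simp: G_def)
    ultimately show ?thesis by (simp add: dec_def uv)
  qed
  let ?T = "\<lambda>X. {i \<in> I. i \<in> X \<longleftrightarrow> i \<in> dec (enc X)}"
  \<comment> \<open>Only an inclusion holds: a bit may come out right although one of its queries
    fails.\<close>
  have "card {j \<in> Pow I \<times> I. \<omega> \<in> A j} \<le> card (SIGMA X : Pow I. ?T X)"
    using I correct by (intro card_mono) (auto intro!: finite_SigmaI)
  also have "\<dots> = (\<Sum>X\<in>Pow I. card (?T X))"
    using I by (subst card_SigmaI) auto
  finally have "7 / 10 * (card I * 2 ^ card I) \<le> (\<Sum>X\<in>Pow I. real (card (?T X)))"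
    using many I by (simp add: card_cartesian_product card_Pow mult.commute flip: of_nat_sum)
  moreover have "enc X \<in> {xs. length xs \<le> s}" if "X \<subseteq> I" for X
    using cs GV[OF that] \<omega> by (simp add: enc_def cut_sketch_def)
  moreover have "finite {xs :: bool list. length xs \<le> s}"
    using finite_lists_length_le[of "UNIV :: bool set" s] by simp
  ultimately show ?thesis
    by (intro random_access_code_bound[OF I _ card_bool_lists_length_le]) auto
qed

section \<open>The host graph and the choice of parameters\<close>

text \<open>Split the vertices into blocks of 2k consecutive numbers and join the first half of each
  block to its second half; the \<open>n mod (2 * k)\<close> leftover vertices stay
  isolated.\<close>

lemma disjoint_bicliques:
  fixes n k :: nat
  assumes "0 < k"
  obtains I where "I \<subseteq> {..<n} \<times> {..<n}" "Domain I \<inter> Range I = {}"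
    "\<And>u. card (I `` {u}) \<le> k" "\<And>v. card (I\<inverse> `` {v}) \<le> k" "card I = n div (2 * k) * k\<^sup>2"
proof -
  let ?m = "2 * k"
  define f where "f = (\<lambda>(j, p, q). (?m * j + p, ?m * j + (k + q)))"
  let ?D = "{..<n div ?m} \<times> {..<k} \<times> {..<k}"
  define I where "I = f ` ?D"
  have divmod: "(?m * j + r) div ?m = j" "(?m * j + r) mod ?m = r" if "r < ?m" for j r
    using that by (simp_all only: mod_mult_self4) (simp_all add: div_mult_self2)
  \<comment> \<open>The quotient by 2k names the block and the remainder the side; disjointness of
    the sides and the degree bounds follow from this.\<close>
  have I: "(u, v) \<in> I \<Longrightarrow> u div ?m = v div ?m \<and> u mod ?m < k \<and> k \<le> v mod ?m" for u v
    by (auto simp: I_def f_def divmod simp del: mod_mult_self1 mod_mult_self2 mod_mult_self3 mod_mult_self4)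
  have dec: "x = ?m * (x div ?m) + x mod ?m" "x mod ?m < ?m" for x using assms by simp_all
  show ?thesis
  proof (rule that)
    show "I \<subseteq> {..<n} \<times> {..<n}"
    proof -
      have "?m * j + r < n" if "j < n div ?m" "r < ?m" for j r
      proof -
        have "?m * j + r < ?m * Suc j" using that by simp
        also have "\<dots> \<le> ?m * (n div ?m)" using that by (intro mult_le_mono2) simp
        also have "\<dots> \<le> n" by simp
        finally show ?thesis .
      qed
      then show ?thesis by (auto simp: I_def f_def)
    qed
    show "Domain I \<inter> Range I = {}" by (auto dest!: I)
    have "I `` {u} \<subseteq> {?m * (u div ?m) + k ..< ?m * (u div ?m) + k + k}" for u
    proof
      fix v assume "v \<in> I `` {u}"
      then show "v \<in> {?m * (u div ?m) + k ..< ?m * (u div ?m) + k + k}"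
        using I[of u v] dec[of v] unfolding atLeastLessThan_iff Image_singleton_iff converse_iff
        by (metis add_le_cancel_left add_less_cancel_left add.assoc le_add1 mult_2)
    qed
    then have "card (I `` {u}) \<le> card {?m * (u div ?m) + k ..< ?m * (u div ?m) + k + k}" for u
      by (intro card_mono) auto
    then show "card (I `` {u}) \<le> k" for u by simp
    have "I\<inverse> `` {v} \<subseteq> {?m * (v div ?m) ..< ?m * (v div ?m) + k}" for v
    proof
      fix u assume "u \<in> I\<inverse> `` {v}"
      then show "u \<in> {?m * (v div ?m) ..< ?m * (v div ?m) + k}"
        using I[of u v] dec[of u] unfolding atLeastLessThan_iff Image_singleton_iff converse_iff
        by (metis add_le_cancel_left add_less_cancel_left add.assoc le_add1 mult_2)
    qed
    then have "card (I\<inverse> `` {v}) \<le> card {?m * (v div ?m) ..< ?m * (v div ?m) + k}" for v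
      by (intro card_mono) auto
    then show "card (I\<inverse> `` {v}) \<le> k" for v by simp
    have "inj_on f ?D"
    proof (rule inj_onI)
      fix x y assume xy: "x \<in> ?D" "y \<in> ?D" "f x = f y"
      obtain j p q j' p' q' where [simp]: "x = (j, p, q)" "y = (j', p', q')" by (cases x, cases y) auto
      have "?m * j + p = ?m * j' + p'" "p < ?m" "p' < ?m" using xy by (auto simp: f_def)
      then have "j = j'" "p = p'" by (metis divmod)+
      then show "x = y" using xy by (auto simp: f_def)
    qed
    then show "card I = n div ?m * k\<^sup>2"
      by (simp add: I_def card_image card_cartesian_product power2_eq_square)
  qed
qed

theorem theorem4p13:
  shows "\<exists>c::real. c > 0 \<and>
    (\<forall>(n::nat) (\<epsilon>::real) (s::nat) (M :: nat seed measure)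
       (sk :: nat seed \<Rightarrow> nat sketcher) (est :: nat seed \<Rightarrow> nat estimator).
       n \<ge> 1 \<longrightarrow> \<epsilon> \<in> {2 / real n .. 1 / 2} \<longrightarrow>
       cut_sketch {..<n} \<epsilon> s M sk est \<longrightarrow>
       real s \<ge> c * real n / \<epsilon>)"
\<comment> \<open>480 = 20 * 4 * 6: 20 from the code bound, 4 from n * k being at most 4 times the
  number of bits, 6 from 1/\<epsilon> being at most 6k.\<close>
proof (rule exI[of _ "1 / 480"], intro conjI allI impI)
  fix n s :: nat and \<epsilon> :: real and M :: "nat seed measure"
    and sk :: "nat seed \<Rightarrow> nat sketcher" and est :: "nat seed \<Rightarrow> nat estimator"
  assume n: "1 \<le> n" and \<epsilon>: "\<epsilon> \<in> {2 / real n .. 1 / 2}" and cs: "cut_sketch {..<n} \<epsilon> s M sk est"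
  \<comment> \<open>The interval for \<epsilon> is empty unless n is at least 4, which also provides
    the third vertex.\<close>
  have "2 / real n \<le> 1 / 2" using \<epsilon> by (meson atLeastAtMost_iff order_trans)
  then have n4: "4 \<le> n" using n by (simp add: field_simps)
  have \<epsilon>0: "0 < \<epsilon>" using \<epsilon> n by (auto intro: less_le_trans[of _ "2 / real n"])
  define r where "r = 1 / \<epsilon>"
  have r: "2 \<le> r" "r \<le> n / 2" using \<epsilon> \<epsilon>0 n by (auto simp: r_def field_simps)
  \<comment> \<open>This is the largest integer k with \<epsilon> * (4k - 2) at most 1; it is
    positive because r is at least 2.\<close>
  define k where "k = nat \<lfloor>(r + 2) / 4\<rfloor>"
  have k: "4 * real k \<le> r + 2" "r + 2 < 4 * real k + 4" "1 \<le> k"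
  proof -
    have "real k = of_int \<lfloor>(r + 2) / 4\<rfloor>" unfolding k_def using r by simp
    then show "4 * real k \<le> r + 2" "r + 2 < 4 * real k + 4"
      using of_int_floor_le[of "(r + 2) / 4"] real_of_int_floor_add_one_gt[of "(r + 2) / 4"]
      by argo+
    then show "1 \<le> k" using r by linarith
  qed
  \<comment> \<open>r < 4k + 2, and 2 is at most 2k.\<close>
  have k6: "r \<le> 6 * real k" using k by linarith
  have "\<epsilon> * (4 * real k - 2) \<le> \<epsilon> * r" using k \<epsilon>0 by (intro mult_left_mono) auto
  then have k\<epsilon>: "\<epsilon> * (4 * real k - 2) \<le> 1" using \<epsilon>0 by (simp add: r_def)
  obtain I where I: "I \<subseteq> {..<n} \<times> {..<n}" "Domain I \<inter> Range I = {}"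
    "\<And>u. card (I `` {u}) \<le> k" "\<And>v. card (I\<inverse> `` {v}) \<le> k" "card I = n div (2 * k) * k\<^sup>2"
    using disjoint_bicliques[of k n] k(3) by auto
  have bound: "card I \<le> 20 * s"
    by (rule cut_sketch_host_bound[OF cs _ _ I(1-4) \<epsilon>0 k\<epsilon>]) (use n4 in auto)
  define b where "b = n div (2 * k)"
  \<comment> \<open>The lower bound 2/n on \<epsilon> enters here through r: at least one block
    fits, so rounding down costs at most a factor 2.\<close>
  have "real (2 * k) \<le> n" using k r n4 by (simp add: field_simps)
  then have "2 * k \<le> n" by linarith
  then have "1 \<le> b" unfolding b_def using k(3) by (simp add: div_greater_zero_iff Suc_le_eq)
  moreover have "n < 2 * k * Suc b" unfolding b_def using k(3) dividend_less_times_div[of "2 * k" n] by simp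
  moreover have "2 * k * Suc b \<le> 2 * k * (2 * b)" using \<open>1 \<le> b\<close> by (intro mult_le_mono2) simp
  ultimately have "n \<le> 2 * k * (2 * b)" by linarith
  then have "n * k \<le> 4 * k * b * k" by (simp add: mult_ac)
  also have "\<dots> = 4 * card I" by (simp add: I(5) b_def power2_eq_square)
  finally have "n * k \<le> 80 * s" using bound by simp
  then have "real n * real k \<le> 80 * real s" by (metis of_nat_le_iff of_nat_mult of_nat_numeral)
  moreover have "real n * r \<le> real n * (6 * real k)" using k6 by (intro mult_left_mono) auto
  ultimately have "1 / 480 * (real n * r) \<le> real s" by simp
  then show "1 / 480 * real n / \<epsilon> \<le> real s" by (simp add: r_def)
qed simp

end
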